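(* Let $K=1$, let $N\in\mathbb{N}_0$ be arbitrary, let $g>0$, and let the friction coefficient be uniformly distributed, $\nu\sim\mathcal{U}(\mu-\sigma,\mu+\sigma)$. Then the stochastic Galerkin shallow water linearised moment equations $\partial_t\boldsymbol{\hat W}+A_{\text{SGSWLME}}(\boldsymbol{\hat W})\partial_x\boldsymbol{\hat W}=\boldsymbol{\hat S}(\boldsymbol{\hat W})$ with system matrix $A_{\text{SGSWLME}}(\boldsymbol{\hat W})\in\mathbb{R}^{2(N+2)\times2(N+2)}$ as defined in the context are hyperbolic on the set of states $\boldsymbol{\hat W}=(\boldsymbol{\hat h},\boldsymbol{\hat q_0},\ldots,\boldsymbol{\hat q_N})$ for which $\mathcal{P}(\boldsymbol{\hat h})$ is positive definite.
   Context: Write $\nu=\mu+\sigma\xi$ with $\xi$ uniform on $[-1,1]$. Let $\psi_0,\psi_1$ be the first two Legendre polynomials, normalised to be orthonormal with respect to the distribution of $\xi$, with $\langle\cdot\rangle$ denoting expectation. For $k=0,1$ let $(\mathcal{M}_k)_{lm}=\langle\psi_k\psi_l\psi_m\rangle$, $0\le l,m\le1$. For $\boldsymbol{\hat\eta}=(\hat\eta_0,\hat\eta_1)^T\in\mathbb{R}^2$ let $\mathcal{P}(\boldsymbol{\hat\eta})=\hat\eta_0\mathcal{M}_0+\hat\eta_1\mathcal{M}_1$, which equals $\begin{pmatrix}\hat\eta_0&\hat\eta_1\\ \hat\eta_1&\hat\eta_0\end{pmatrix}$. The state is $\boldsymbol{\hat W}=(\boldsymbol{\hat h},\boldsymbol{\hat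 q_0},\ldots,\boldsymbol{\hat q_N})$ with $\boldsymbol{\hat h},\boldsymbol{\hat q_j}\in\mathbb{R}^2$; put $\boldsymbol{\hat u_j}=\mathcal{P}(\boldsymbol{\hat h})^{-1}\boldsymbol{\hat q_j}$. Abbreviate $H=\mathcal{P}(\boldsymbol{\hat h})$, $Q_j=\mathcal{P}(\boldsymbol{\hat q_j})$, $U_j=\mathcal{P}(\boldsymbol{\hat u_j})$, and let $O,I$ be the $2\times2$ zero and identity matrices. The system matrix consists of $2\times2$ blocks (blank blocks are zero): $$A_{\text{SGSWLME}}(\boldsymbol{\hat W})=\begin{pmatrix}O&I&O&\cdots&O\\ gH-\sum_{j=0}^N\frac{Q_jH^{-1}U_j}{2j+1} & Q_0H^{-1}+U_0 & \frac{Q_1H^{-1}+U_1}{3}&\cdots&\frac{Q_NH^{-1}+U_N}{2N+1}\\ -Q_0H^{-1}U_1-Q_1H^{-1}U_0 & Q_1H^{-1}+U_1 & Q_0H^{-1}&&\\ \vdots&\vdots&&\ddots&\\ -Q_0H^{-1}U_N-Q_NH^{-1}U_0 & Q_NH^{-1}+U_N&&&Q_0H^{-1}\end{pmatrix}.$$ The right-hand side $\boldsymbol{\hat S}(\boldsymbol{\hat W})$ is a friction source term depending on $\boldsymbol{\hat W}$ but not on its derivatives; it plays no role in hyperbolicity. A first-order system with system matrix $A(\boldsymbol{\hat W})$ is called hyperbolic if $A(\boldsymbol{\hat W})$ is diagonalisable with real eigenvalues for all states $\boldsymbol{\hat W}$ under consideration. *)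

theory Defs
  imports
    "HOL-Probability.Probability"
    "Jordan_Normal_Form.Char_Poly"
    "Jordan_Normal_Form.Gauss_Jordan_Elimination"
begin

no_notation vec_nth (infixl "$" 90)  (* frees $ for vec_index *)

section \<open>Hyperbolic first-order systems\<close>

text \<open>
  The quasilinear system W_t + A(W) W_x = S(W) for a state W with n components is given by
  its system matrix A and its source term S.
\<close>

record first_order_system =
  sysmat :: "real Matrix.vec \<Rightarrow> real Matrix.mat"
  source :: "real Matrix.vec \<Rightarrow> real Matrix.vec"

definition diagonalisable :: "'a::field Matrix.mat \<Rightarrow> bool" where
  "diagonalisable A \<longleftrightarrow> (\<exists>D. diagonal_mat D \<and> similar_mat A D)"

text \<open>
  The eigenvalues are those over the complex numbers: the real eigenvalues of a real matrix
  are trivially real.  Diagonalisability is over the reals, that is, by real eigenvectors.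
\<close>

definition hyperbolic_on :: "first_order_system \<Rightarrow> real Matrix.vec set \<Rightarrow> bool" where
  "hyperbolic_on sys D \<longleftrightarrow>
     (\<forall>W\<in>D. diagonalisable (sysmat sys W) \<and>
       (\<forall>z. eigenvalue (map_mat complex_of_real (sysmat sys W)) z \<longrightarrow> z \<in> \<real>))"

definition positive_definite :: "real Matrix.mat \<Rightarrow> bool" where
  "positive_definite A \<longleftrightarrow>
     transpose_mat A = A \<and>
     (\<forall>v\<in>carrier_vec (dim_row A). v \<noteq> 0\<^sub>v (dim_row A) \<longrightarrow> 0 < scalar_prod v (A *\<^sub>v v))"

section \<open>Stochastic Galerkin matrices\<close>

text \<open>Rodrigues' formula.\<close>

definition legendre_poly :: "nat \<Rightarrow> real poly" where
  "legendre_poly k = Polynomial.smult (1 / (2 ^ k * fact k)) ((pderiv ^^ k) ([:-1, 0, 1:] ^ k))"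

text \<open>In this section L is the law of the random variable in which one expands.\<close>

definition psi :: "real measure \<Rightarrow> nat \<Rightarrow> real \<Rightarrow> real" where
  "psi L k x = poly (legendre_poly k) x / sqrt (\<integral>y. (poly (legendre_poly k) y)\<^sup>2 \<partial>L)"

definition galerkin_tensor :: "real measure \<Rightarrow> nat \<Rightarrow> real Matrix.mat" where
  "galerkin_tensor L k = Matrix.mat 2 2 (\<lambda>(l, m). \<integral>x. psi L k x * psi L l x * psi L m x \<partial>L)"

definition galerkin_mat :: "real measure \<Rightarrow> real Matrix.vec \<Rightarrow> real Matrix.mat" where
  "galerkin_mat L v = (v $ 0) \<cdot>\<^sub>m galerkin_tensor L 0 + (v $ 1) \<cdot>\<^sub>m galerkin_tensor L 1"

section \<open>The stochastic Galerkin shallow water linearised moment equations\<close>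

text \<open>
  A state is a vector with 2 * (N + 2) entries.  Its consecutive pairs of entries, numbered
  from 0, are h, q_0, ..., q_N.
\<close>

definition h_part :: "real Matrix.vec \<Rightarrow> real Matrix.vec" where
  "h_part W = Matrix.vec 2 (\<lambda>i. W $ i)"

definition q_part :: "real Matrix.vec \<Rightarrow> nat \<Rightarrow> real Matrix.vec" where
  "q_part W j = Matrix.vec 2 (\<lambda>i. W $ (2 * (j + 1) + i))"

text \<open>
  The 2 by 2 block in block row r and block column c, both in {0..N + 1}; index j + 1
  belongs to q_j.  The sum is formed entrywise since matrices do not form a type-class monoid.
\<close>

definition sgswlme_block ::
    "real measure \<Rightarrow> real \<Rightarrow> nat \<Rightarrow> real Matrix.vec \<Rightarrow> nat \<Rightarrow> nat \<Rightarrow> real Matrix.mat" where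
  "sgswlme_block L g N W r c =
    (let H = galerkin_mat L (h_part W);
         H' = the (mat_inverse H);
         Q = (\<lambda>j. galerkin_mat L (q_part W j));
         U = (\<lambda>j. galerkin_mat L (H' *\<^sub>v q_part W j))
     in
       if r = 0 then
         (if c = 1 then 1\<^sub>m 2 else 0\<^sub>m 2 2)
       else if r = 1 then
         (if c = 0 then
            g \<cdot>\<^sub>m H - Matrix.mat 2 2 (\<lambda>ab. \<Sum>j=0..N. (Q j * H' * U j) $$ ab / (2 * real j + 1))
          else
            (let j = c - 1 in (1 / (2 * real j + 1)) \<cdot>\<^sub>m (Q j * H' + U j)))
       else
         (let j = r - 1 in
          if c = 0 then - (Q 0 * H' * U j) - Q j * H' * U 0
          else if c = 1 then Q j * H' + U j
          else if c = r then Q 0 * H'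
          else 0\<^sub>m 2 2))"

definition sgswlme_matrix ::
    "real measure \<Rightarrow> real \<Rightarrow> nat \<Rightarrow> real Matrix.vec \<Rightarrow> real Matrix.mat" where
  "sgswlme_matrix L g N W =
     Matrix.mat (2 * (N + 2)) (2 * (N + 2))
       (\<lambda>(a, b). sgswlme_block L g N W (a div 2) (b div 2) $$ (a mod 2, b mod 2))"

definition sgswlme_states :: "real measure \<Rightarrow> nat \<Rightarrow> real Matrix.vec set" where
  "sgswlme_states L N =
     {W \<in> carrier_vec (2 * (N + 2)). positive_definite (galerkin_mat L (h_part W))}"

end

theory Submission
  imports Defs
begin

text \<open>
  The Galerkin matrix of v is symmetric with constant diagonal, so all these matrices commute
  and have the eigenvectors (1, 1) and (1, -1), with eigenvalues v 0 + v 1 and v 0 - v 1.  The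
  system matrix therefore splits into two deterministic moment matrices, each with positive
  height h and velocities u j.  Let \<Sigma> be the sum of u j ^ 2 / (2 j + 1) over j \<ge> 1 and
  c = sqrt (g h + 3 \<Sigma>) > 0.  Such a matrix has the eigenvalues u 0 + c and u 0 - c, each once,
  and u 0 with multiplicity N.  In the coordinates y j = x (j + 1) - 2 u j x 0 and
  z = x 1 - u 0 x 0 the matrix minus u 0 kills the y j and acts on (x 0, z) by
  x 0 to z, z to c^2 x 0 plus a combination of the y j, which gives an explicit basis of left
  eigenvectors without case distinction on the u j.
\<close>

section \<open>Left eigenbases\<close>

text \<open>The second conjunct is linear independence of the rows, put as triviality of the kernel
  of the square matrix \<open>l\<close>, because that is checked by solving equations. Entries are
  functions of indices, so that pairs of rows and columns can be handled with plain sums.\<close>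

definition left_eigenbasis ::
    "nat \<Rightarrow> (nat \<Rightarrow> nat \<Rightarrow> 'a::field) \<Rightarrow> (nat \<Rightarrow> nat \<Rightarrow> 'a) \<Rightarrow> (nat \<Rightarrow> 'a) \<Rightarrow> bool" where
  "left_eigenbasis n a l d \<longleftrightarrow>
     (\<forall>i<n. \<forall>c<n. (\<Sum>r<n. l i r * a r c) = d i * l i c) \<and>
     (\<forall>x. (\<forall>i<n. (\<Sum>r<n. l i r * x r) = 0) \<longrightarrow> (\<forall>r<n. x r = 0))"

lemma left_eigenbasisD:
  assumes "left_eigenbasis n a l d"
  shows "i < n \<Longrightarrow> c < n \<Longrightarrow> (\<Sum>r<n. l i r * a r c) = d i * l i c"
    and "(\<And>i. i < n \<Longrightarrow> (\<Sum>r<n. l i r * x r) = 0) \<Longrightarrow> r < n \<Longrightarrow> x r = 0"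
  using assms by (simp_all add: left_eigenbasis_def)

text \<open>With the left eigenvectors as rows of \<open>Q\<close> the first conjunct reads
  \<open>Q * A = D * Q\<close>; the trivial kernel makes \<open>Q\<close> invertible.\<close>

lemma diagonalisable_if_left_eigenbasis:
  assumes "left_eigenbasis n a l d"
  shows "diagonalisable (Matrix.mat n n (\<lambda>(r, c). a r c))"
proof -
  define A where "A = Matrix.mat n n (\<lambda>(r, c). a r c)"
  define Q where "Q = Matrix.mat n n (\<lambda>(i, r). l i r)"
  define D where "D = Matrix.mat n n (\<lambda>(i, j). if i = j then d i else 0)"
  have [simp]: "A \<in> carrier_mat n n" "Q \<in> carrier_mat n n" "D \<in> carrier_mat n n"
    by (auto simp: A_def Q_def D_def)
  have QA: "Q * A = D * Q"
  proof (rule eq_matI)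
    fix i c assume "i < dim_row (D * Q)" "c < dim_col (D * Q)"
    then have ic: "i < n" "c < n" by (simp_all add: D_def Q_def)
    have "(Q * A) $$ (i, c) = (\<Sum>r<n. l i r * a r c)"
      using ic by (simp add: Q_def A_def scalar_prod_def lessThan_atLeast0)
    also have "\<dots> = d i * l i c"
      using assms ic by (simp add: left_eigenbasis_def)
    also have "\<dots> = (\<Sum>j<n. (if i = j then d i else 0) * l j c)"
      using ic by (simp add: if_distrib[of "\<lambda>x. x * _"] cong: if_cong)
    also have "\<dots> = (D * Q) $$ (i, c)"
      using ic by (simp add: Q_def D_def scalar_prod_def lessThan_atLeast0)
    finally show "(Q * A) $$ (i, c) = (D * Q) $$ (i, c)" .
  qed (simp_all add: A_def Q_def D_def)
  have "det Q \<noteq> 0"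
  proof
    assume "det Q = 0"
    then obtain v where v: "v \<in> carrier_vec n" "v \<noteq> 0\<^sub>v n" "Q *\<^sub>v v = 0\<^sub>v n"
      using det_0_iff_vec_prod_zero[of Q n] by auto
    have "(\<Sum>r<n. l i r * v $ r) = 0" if "i < n" for i
    proof -
      have "(\<Sum>r<n. l i r * v $ r) = (Q *\<^sub>v v) $ i"
        using that v(1) by (simp add: Q_def scalar_prod_def lessThan_atLeast0)
      then show ?thesis using v(3) that by simp
    qed
    then have "\<forall>r<n. v $ r = 0"
      using assms unfolding left_eigenbasis_def by blast
    then have "v = 0\<^sub>v n" using v(1) by (intro eq_vecI) auto
    with v(2) show False by simp
  qed
  then have "Q \<in> Units (ring_mat TYPE('a) n ())"
    by (intro det_non_zero_imp_unit) simp_all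
  then obtain P where P[simp]: "P \<in> carrier_mat n n" and PQ: "P * Q = 1\<^sub>m n" "Q * P = 1\<^sub>m n"
    by (auto simp: Units_def ring_mat_def)
  have "A = (P * Q) * A" by (simp add: PQ left_mult_one_mat[of A n n])
  also have "\<dots> = P * D * Q"
    by (simp add: assoc_mult_mat[of _ n n _ n _ n] QA)
  finally have "A = P * D * Q" .
  then have "similar_mat_wit A D P Q"
    by (rule similar_mat_witI[OF PQ]) simp_all
  moreover have "diagonal_mat D"
    by (auto simp: diagonal_mat_def D_def)
  ultimately show ?thesis
    unfolding diagonalisable_def similar_mat_def A_def by blast
qed

text \<open>Similarity preserves the characteristic polynomial, which for a real diagonal matrix is
  a product of real linear factors, also when read over the complex numbers.\<close>

lemma complex_eigenvalue_of_diagonalisable_real: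
  assumes "A \<in> carrier_mat n n" "diagonalisable A"
    and "eigenvalue (map_mat complex_of_real A) z"
  shows "z \<in> \<real>"
proof -
  obtain D where D: "diagonal_mat D" "similar_mat A D"
    using assms(2) by (auto simp: diagonalisable_def)
  then have Dn: "D \<in> carrier_mat n n"
    using assms(1) similar_matD by fastforce
  interpret poly_hom: map_poly_comm_ring_hom complex_of_real ..
  have "char_poly A = (\<Prod>a\<leftarrow>diag_mat D. [:- a, 1:])"
    using char_poly_similar[OF D(2)] char_poly_upper_triangular[OF Dn] D(1) Dn
    by (auto simp: diagonal_mat_def upper_triangular_def)
  moreover have "poly (char_poly (map_mat complex_of_real A)) z = 0"
    using assms(1,3) eigenvalue_root_char_poly[of "map_mat complex_of_real A" n z] by simp
  ultimately have "poly (map_poly complex_of_real (\<Prod>a\<leftarrow>diag_mat D. [:- a, 1:])) z = 0"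
    by (simp add: of_real_hom.char_poly_hom[OF assms(1)])
  moreover have "poly (map_poly complex_of_real (\<Prod>a\<leftarrow>as. [:- a, 1:])) z
      = (\<Prod>a\<leftarrow>as. z - complex_of_real a)" for as
    by (induction as) (simp_all add: poly_hom.hom_mult algebra_simps del: mult_pCons_left)
  ultimately have "\<exists>a\<in>set (diag_mat D). z = complex_of_real a"
    by (auto simp: prod_list_zero_iff)
  then show ?thesis by auto
qed

section \<open>Combining two matrices along sums and differences of pairs\<close>

lemma sum_lessThan_double:
  "(\<Sum>k<2 * m. f k) = (\<Sum>c<m. f (2 * c) + f (2 * c + 1))"
  for f :: "nat \<Rightarrow> 'a::comm_monoid_add"
  by (induction m) (simp_all add: algebra_simps)

text \<open>
  The matrices a 0 and a 1 act on the sums and the differences of consecutive pairs of entries.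
\<close>

lemma left_eigenbasis_interleave:
  fixes a l :: "nat \<Rightarrow> nat \<Rightarrow> nat \<Rightarrow> real"
  assumes "\<And>e. e < 2 \<Longrightarrow> left_eigenbasis m (a e) (l e) (d e)"
  shows "left_eigenbasis (2 * m)
    (\<lambda>r c. (a 0 (r div 2) (c div 2) + (-1) ^ (r + c) * a 1 (r div 2) (c div 2)) / 2)
    (\<lambda>i r. (-1) ^ (i * r) * l (i mod 2) (i div 2) (r div 2))
    (\<lambda>i. d (i mod 2) (i div 2))"
    (is "left_eigenbasis _ ?a ?l ?d")
proof -
  have half: "2 * r div 2 = r" "(2 * r + 1) div 2 = r" for r :: nat
    by simp_all
  show ?thesis
    unfolding left_eigenbasis_def
  proof (intro conjI allI impI)
    fix i c assume ic: "i < 2 * m" "c < 2 * m"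
    let ?e = "i mod 2" and ?k = "i div 2"
    have sign: "(-1 :: real) ^ (i * (2 * r)) = 1" "(-1 :: real) ^ (i * (2 * r + 1)) = (-1) ^ i"
      "(-1 :: real) ^ (2 * r + c) = (-1) ^ c" "(-1 :: real) ^ (2 * r + 1 + c) = - ((-1) ^ c)" for r
      by (simp_all add: minus_one_power_iff)
    \<comment> \<open>Row i is a left eigenvector of \<open>a ?e\<close>, each entry x replaced by
      the pair (x, x) for even i and (x, -x) for odd i. Over a pair of matrix rows the contributions
      of the other matrix cancel, and the two halves of \<open>a ?e\<close> add up.\<close>
    have "?l i (2 * r) * ?a (2 * r) c + ?l i (2 * r + 1) * ?a (2 * r + 1) c
        = (-1) ^ (i * c) * (l ?e ?k r * a ?e r (c div 2))" for r
    proof (cases "even i")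
      case True
      then have "?e = 0" "(-1 :: real) ^ i = 1" "(-1 :: real) ^ (i * c) = 1"
        by (simp_all add: power_mult)
      then show ?thesis unfolding sign half by (simp only: mult_1_left) (simp add: field_simps)
    next
      case False
      then have "?e = 1" "(-1 :: real) ^ i = -1" "(-1 :: real) ^ (i * c) = (-1) ^ c"
        by (simp_all add: power_mult odd_iff_mod_2_eq_one)
      then show ?thesis unfolding sign half by (simp only: mult_1_left) (simp add: field_simps)
    qed
    then have "(\<Sum>r<2 * m. ?l i r * ?a r c)
        = (\<Sum>r<m. (-1) ^ (i * c) * (l ?e ?k r * a ?e r (c div 2)))"
      unfolding sum_lessThan_double by (intro sum.cong refl)
    also have "\<dots> = (-1) ^ (i * c) * (\<Sum>r<m. l ?e ?k r * a ?e r (c div 2))"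
      by (simp add: sum_distrib_left)
    also have "(\<Sum>r<m. l ?e ?k r * a ?e r (c div 2)) = d ?e ?k * l ?e ?k (c div 2)"
    proof -
      have "?k < m" "c div 2 < m" using ic by auto
      then show ?thesis
        by (intro left_eigenbasisD(1)[OF assms]) simp_all
    qed
    finally show "(\<Sum>r<2 * m. ?l i r * ?a r c) = ?d i * ?l i c" by simp
  next
    fix x :: "nat \<Rightarrow> real" and r
    assume x: "\<forall>i<2 * m. (\<Sum>r<2 * m. ?l i r * x r) = 0" and r: "r < 2 * m"
    \<comment> \<open>For fixed e the rows 2 k + e test only the vector of pair sums (e = 0) or pair
      differences (e = 1). Both vectors vanish by independence of \<open>l e\<close>, hence so does
      x.\<close>
    have z: "x (2 * s) + (-1) ^ e * x (2 * s + 1) = 0" if "e < 2" "s < m" for e s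
    proof -
      have "(\<Sum>r<m. l e k r * (x (2 * r) + (-1) ^ e * x (2 * r + 1))) = 0" if "k < m" for k
      proof -
        have e: "(2 * k + e) mod 2 = e" "(2 * k + e) div 2 = k"
          using \<open>e < 2\<close> by auto
        have sign: "(-1 :: real) ^ ((2 * k + e) * (2 * r)) = 1"
          "(-1 :: real) ^ ((2 * k + e) * (2 * r + 1)) = (-1) ^ e" for r
          by (simp_all add: minus_one_power_iff)
        have "l e k r * (x (2 * r) + (-1) ^ e * x (2 * r + 1))
            = ?l (2 * k + e) (2 * r) * x (2 * r) + ?l (2 * k + e) (2 * r + 1) * x (2 * r + 1)" for r
          unfolding e sign half by (simp add: algebra_simps)
        then have "(\<Sum>r<m. l e k r * (x (2 * r) + (-1) ^ e * x (2 * r + 1)))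
            = (\<Sum>r<2 * m. ?l (2 * k + e) r * x r)"
          unfolding sum_lessThan_double by (intro sum.cong refl)
        also have "\<dots> = 0"
          using x[rule_format, of "2 * k + e"] \<open>e < 2\<close> that by linarith
        finally show ?thesis .
      qed
      from left_eigenbasisD(2)[OF assms[OF \<open>e < 2\<close>] this \<open>s < m\<close>] show ?thesis .
    qed
    have s: "r div 2 < m" using r by auto
    have "x (2 * (r div 2)) = 0" "x (2 * (r div 2) + 1) = 0"
      using z[of 0 "r div 2"] z[of 1 "r div 2"] s by simp_all
    then show "x r = 0"
      by (cases "even r") (simp_all add: odd_two_times_div_two_succ)
  qed
qed

section \<open>The deterministic moment equations\<close>

text \<open>This is the system matrix with its 2 by 2 blocks replaced by scalars: height h and
  velocities u j = q j / h, so that Q_j H^-1 U_j becomes the square of u j. Index j + 1 belongs to u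
  j.\<close>

definition swlme_entry :: "real \<Rightarrow> real \<Rightarrow> (nat \<Rightarrow> real) \<Rightarrow> nat \<Rightarrow> nat \<Rightarrow> nat \<Rightarrow> real" where
  "swlme_entry g h u N r c =
    (if r = 0 then (if c = 1 then 1 else 0)
     else if r = 1 then
       (if c = 0 then g * h - (\<Sum>j=0..N. (u j)\<^sup>2 / (2 * real j + 1))
        else 2 * u (c - 1) / (2 * real (c - 1) + 1))
     else
       (if c = 0 then - (2 * (u 0 * u (r - 1)))
        else if c = 1 then 2 * u (r - 1)
        else if c = r then u 0 else 0))"

lemma sum_lessThan_Suc_Suc_shift:
  "(\<Sum>r<N + 2. f r) = f 0 + f 1 + (\<Sum>j=1..N. f (Suc j))"
  for f :: "nat \<Rightarrow> 'a::comm_monoid_add"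
proof -
  have "(\<Sum>r<N + 2. f r) = f 0 + (f 1 + (\<Sum>j<N. f (Suc (Suc j))))"
    by (simp add: sum.lessThan_Suc_shift del: sum.lessThan_Suc)
  also have "(\<Sum>j<N. f (Suc (Suc j))) = (\<Sum>j=1..N. f (Suc j))"
    by (rule sum.reindex_bij_witness[of _ "\<lambda>j. j - 1" Suc]) auto
  finally show ?thesis by (simp add: add.assoc)
qed

lemma swlme_left_eigenbasis:
  fixes u :: "nat \<Rightarrow> real"
  assumes "0 < g * h"
  shows "\<exists>l d. left_eigenbasis (N + 2) (swlme_entry g h u N) l d"
proof -
  define \<Sigma> where "\<Sigma> = (\<Sum>j=1..N. (u j)\<^sup>2 / (2 * real j + 1))"
  \<comment> \<open>In the action on z the coefficient of x 0 is g h - \<Sigma> from the matrix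
    entry, plus 4 \<Sigma> from substituting x (j + 1) = y j + 2 u j x 0.\<close>
  define c where "c = sqrt (g * h + 3 * \<Sigma>)"
  have "0 \<le> \<Sigma>" unfolding \<Sigma>_def by (intro sum_nonneg) auto
  then have c: "0 < c" and gh: "g * h = c\<^sup>2 - 3 * \<Sigma>"
    using assms by (auto simp: c_def)
  \<comment> \<open>These are the entries of row 1 in the columns j + 1, hence the weights of the y
    j in the action on z.\<close>
  define a where "a j = 2 * u j / (2 * real j + 1)" for j
  define e :: "nat \<Rightarrow> real" where "e i = (if i = 0 then 1 else -1)" for i
  have au: "(\<Sum>j=1..N. a j * u j) = 2 * \<Sigma>"
    unfolding \<Sigma>_def sum_distrib_left a_def
    by (intro sum.cong refl) (simp add: power2_eq_square)
  \<comment> \<open>Rows 0 and 1 are x 0 + (\<Sum>j. a j * y j) / c^2 \<plusminus> z / c, written in the original coordinates.\<close>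
  define l where "l i r =
    (if i < 2 then
       (if r = 0 then 1 - 4 * \<Sigma> / c\<^sup>2 - e i * u 0 / c
        else if r = 1 then e i / c
        else a (r - 1) / c\<^sup>2)
     else
       (if r = 0 then - 2 * u (i - 1) else if r = i then 1 else 0))" for i r
  \<comment> \<open>Rows i \<ge> 2 of \<open>l\<close> are the forms y (i - 1). On rows 0 and 1 the
    matrix minus u 0 turns x 0 into z, and e z / c into e c (x 0 + (sum of a j y j) / c^2), with e =
    \<open>e i\<close>; since e^2 = 1, the result is e c times the row.\<close>
  define d where "d i = (if i < 2 then u 0 + e i * c else u 0)" for i
  have sum0: "(\<Sum>j=0..N. (u j)\<^sup>2 / (2 * real j + 1)) = (u 0)\<^sup>2 + \<Sigma>"
    by (simp add: \<Sigma>_def sum.atLeast_Suc_atMost)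
  have e2: "e i * e i = 1" for i by (simp add: e_def)
  have pick: "(\<Sum>j=1..N. (if j = k then f j else 0)) = f k" if "1 \<le> k" "k \<le> N"
    for f :: "nat \<Rightarrow> real" and k
    using that by (simp add: sum.delta)
  have "left_eigenbasis (N + 2) (swlme_entry g h u N) l d"
    unfolding left_eigenbasis_def
  proof (intro conjI allI impI)
    fix i k assume i: "i < N + 2" and k: "k < N + 2"
    consider "k = 0" | "k = 1" | "1 \<le> k - 1" "k - 1 \<le> N" "k \<noteq> 0" "k \<noteq> 1"
      using k by linarith
    note kcases = this
    show "(\<Sum>r<N + 2. l i r * swlme_entry g h u N r k) = d i * l i k"
    proof (cases "i < 2")
      case True
      from kcases show ?thesis
      proof cases
        case 1
        have "(\<Sum>j=1..N. l i (Suc j) * swlme_entry g h u N (Suc j) k)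
            = (\<Sum>j=1..N. (- 2 * u 0 / c\<^sup>2) * (a j * u j))"
          using True 1 by (intro sum.cong) (auto simp: l_def swlme_entry_def)
        also have "\<dots> = (- 2 * u 0 / c\<^sup>2) * (2 * \<Sigma>)"
          by (simp only: au flip: sum_distrib_left)
        \<comment> \<open>Replacing g h by c^2 - 3 \<Sigma> leaves an identity in u 0, c and
          \<Sigma> alone.\<close>
        finally have "(\<Sum>r<N + 2. l i r * swlme_entry g h u N r k)
            = e i / c * (c\<^sup>2 - 4 * \<Sigma> - (u 0)\<^sup>2) - 4 * u 0 * \<Sigma> / c\<^sup>2"
          unfolding sum_lessThan_Suc_Suc_shift
          using True 1 sum0 gh by (simp add: l_def swlme_entry_def mult_ac)
        also have "\<dots> = (u 0 + e i * c) * (1 - 4 * \<Sigma> / c\<^sup>2 - e i * u 0 / c)"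
          using c by (cases "i = 0") (simp_all add: e_def field_simps power2_eq_square)
        finally show ?thesis using True 1 by (simp add: l_def d_def)
      next
        case 2
        have "(\<Sum>j=1..N. l i (Suc j) * swlme_entry g h u N (Suc j) k)
            = (\<Sum>j=1..N. (2 / c\<^sup>2) * (a j * u j))"
          using True 2 by (intro sum.cong) (auto simp: l_def swlme_entry_def)
        also have "\<dots> = (2 / c\<^sup>2) * (2 * \<Sigma>)"
          by (simp only: au flip: sum_distrib_left)
        finally show ?thesis unfolding sum_lessThan_Suc_Suc_shift
          using True 2 c e2[of i]
          by (simp add: l_def d_def swlme_entry_def field_simps)
      next
        case 3
        have "(\<Sum>j=1..N. l i (Suc j) * swlme_entry g h u N (Suc j) k)
            = (\<Sum>j=1..N. if j = k - 1 then u 0 * a j / c\<^sup>2 else 0)"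
          using True 3 by (intro sum.cong) (auto simp: l_def swlme_entry_def)
        also have "\<dots> = u 0 * a (k - 1) / c\<^sup>2"
          using 3 by (subst pick) auto
        finally show ?thesis unfolding sum_lessThan_Suc_Suc_shift
          using True 3 c
          by (simp add: l_def d_def swlme_entry_def a_def field_simps power2_eq_square)
      qed
    next
      case False
      \<comment> \<open>The form y (i - 1) involves only matrix rows 0 and i. In column 1 the entry
        2 u (i - 1) cancels against the 1 of row 0; what remains is u 0 times the form.\<close>
      have "(\<Sum>j=1..N. l i (Suc j) * swlme_entry g h u N (Suc j) k)
          = (\<Sum>j=1..N. if j = i - 1 then swlme_entry g h u N i k else 0)"
        using False by (intro sum.cong) (auto simp: l_def)
      also have "\<dots> = swlme_entry g h u N i k"
        using False i by (subst pick) auto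
      finally show ?thesis unfolding sum_lessThan_Suc_Suc_shift
        using False by (auto simp: l_def d_def swlme_entry_def)
    qed
  next
    fix x :: "nat \<Rightarrow> real" and r
    assume x: "\<forall>i<N + 2. (\<Sum>r<N + 2. l i r * x r) = 0" and r: "r < N + 2"
    \<comment> \<open>Rows i \<ge> 2 say that all y j vanish. Rows 0 and 1 then reduce to x 0 + z /
      c = 0 and x 0 - z / c = 0.\<close>
    have xj: "x (Suc j) = 2 * u j * x 0" if j: "1 \<le> j" "j \<le> N" for j
    proof -
      have "(\<Sum>k=1..N. l (Suc j) (Suc k) * x (Suc k))
          = (\<Sum>k=1..N. if k = j then x (Suc k) else 0)"
        using j by (intro sum.cong) (auto simp: l_def)
      also have "\<dots> = x (Suc j)" using j by (subst pick) auto
      finally show ?thesis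
        using x[rule_format, of "Suc j"] j unfolding sum_lessThan_Suc_Suc_shift
        by (simp add: l_def)
    qed
    have p: "x 0 + e i * ((x 1 - u 0 * x 0) / c) = 0" if "i < 2" for i
    proof -
      have "(\<Sum>j=1..N. l i (Suc j) * x (Suc j)) = (\<Sum>j=1..N. (2 * x 0 / c\<^sup>2) * (a j * u j))"
        using that xj by (intro sum.cong) (auto simp: l_def)
      also have "\<dots> = (2 * x 0 / c\<^sup>2) * (2 * \<Sigma>)"
        by (simp only: au flip: sum_distrib_left)
      finally show ?thesis
        using x[rule_format, of i] that c unfolding sum_lessThan_Suc_Suc_shift
        by (simp add: l_def algebra_simps diff_divide_distrib)
    qed
    define t where "t = (x 1 - u 0 * x 0) / c"
    have "x 0 + t = 0" "x 0 - t = 0"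
      using p[of 0] p[of 1] unfolding t_def[symmetric] by (simp_all add: e_def)
    then have x0: "x 0 = 0" and "t = 0" by linarith+
    then have x1: "x 1 = 0" using c by (simp add: t_def)
    consider "r = 0" | "r = 1" | j where "r = Suc j" "1 \<le> j" "j \<le> N"
      using r by (cases r) (auto, force)
    then show "x r = 0" using x0 x1 xj by cases auto
  qed
  then show ?thesis by blast
qed

section \<open>The Galerkin matrices\<close>

text \<open>The symmetric matrix with eigenvalue p on (1, 1) and m on (1, -1).\<close>

definition swap_mat :: "real \<Rightarrow> real \<Rightarrow> real Matrix.mat" where
  "swap_mat p m = Matrix.mat 2 2 (\<lambda>(i, j). (p + (-1) ^ (i + j) * m) / 2)"

lemma swap_mat_carrier [simp]: "swap_mat p m \<in> carrier_mat 2 2"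
  by (simp add: swap_mat_def)

lemma swap_mat_dims [simp]: "dim_row (swap_mat p m) = 2" "dim_col (swap_mat p m) = 2"
  by (simp_all add: swap_mat_def)

lemma swap_mat_index:
  "i < 2 \<Longrightarrow> j < 2 \<Longrightarrow> swap_mat p m $$ (i, j) = (p + (-1) ^ (i + j) * m) / 2"
  by (simp add: swap_mat_def)

lemma swap_mat_mult: "swap_mat p m * swap_mat p' m' = swap_mat (p * p') (m * m')"
  by (rule eq_matI)
    (auto simp: swap_mat_def scalar_prod_def less_2_cases_iff numeral_2_eq_2 power_add field_simps)

lemma swap_mat_add: "swap_mat p m + swap_mat p' m' = swap_mat (p + p') (m + m')"
  by (rule eq_matI) (auto simp: swap_mat_def less_2_cases_iff field_simps)

lemma swap_mat_uminus: "- swap_mat p m = swap_mat (- p) (- m)"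
  by (rule eq_matI) (auto simp: swap_mat_def less_2_cases_iff field_simps)

lemma swap_mat_minus: "swap_mat p m - swap_mat p' m' = swap_mat (p - p') (m - m')"
  by (rule eq_matI) (auto simp: swap_mat_def less_2_cases_iff field_simps)

lemma swap_mat_smult: "t \<cdot>\<^sub>m swap_mat p m = swap_mat (t * p) (t * m)"
  by (rule eq_matI) (auto simp: swap_mat_def less_2_cases_iff field_simps)

lemma swap_mat_one: "1\<^sub>m 2 = swap_mat 1 1"
  by (rule eq_matI) (auto simp: swap_mat_def less_2_cases_iff)

lemma swap_mat_zero: "0\<^sub>m 2 2 = swap_mat 0 0"
  by (rule eq_matI) (auto simp: swap_mat_def)

lemma swap_mat_sum:
  "Matrix.mat 2 2 (\<lambda>ab. \<Sum>j\<in>J. swap_mat (p j) (m j) $$ ab / t j)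
     = swap_mat (\<Sum>j\<in>J. p j / t j) (\<Sum>j\<in>J. m j / t j)"
  by (rule eq_matI)
    (simp_all add: swap_mat_def sum_distrib_left sum_divide_distrib sum.distrib
      add_divide_distrib mult.commute)

lemma swap_mat_mult_vec:
  assumes "v \<in> carrier_vec 2"
  shows "(swap_mat p m *\<^sub>v v) $ 0 + (swap_mat p m *\<^sub>v v) $ 1 = p * (v $ 0 + v $ 1)"
    and "(swap_mat p m *\<^sub>v v) $ 0 - (swap_mat p m *\<^sub>v v) $ 1 = m * (v $ 0 - v $ 1)"
  using assms
  by (auto simp: swap_mat_def scalar_prod_def numeral_2_eq_2 field_simps)

text \<open>Gauss-Jordan elimination is not evaluated: it succeeds because the matrix is a unit, and
  uniqueness of inverses identifies its result.\<close>

lemma mat_inverse_swap_mat: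
  assumes "p \<noteq> 0" "m \<noteq> 0"
  shows "mat_inverse (swap_mat p m) = Some (swap_mat (1 / p) (1 / m))"
proof -
  let ?A = "swap_mat p m" and ?B = "swap_mat (1 / p) (1 / m)"
  have AB: "?A * ?B = 1\<^sub>m 2" "?B * ?A = 1\<^sub>m 2"
    using assms by (simp_all add: swap_mat_mult swap_mat_one)
  have "?A \<in> Units (ring_mat TYPE(real) 2 ())"
    unfolding Units_def ring_mat_def using AB by force
  then obtain C where C: "mat_inverse ?A = Some C"
    using mat_inverse(1)[of ?A 2 "()"] by (cases "mat_inverse ?A") auto
  then have CA: "C * ?A = 1\<^sub>m 2" "C \<in> carrier_mat 2 2"
    using mat_inverse(2)[of ?A 2 C] by auto
  have "C = C * (?A * ?B)" using CA AB by simp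
  also have "\<dots> = ?B"
    using CA by (simp add: CA flip: assoc_mult_mat[of _ 2 2 _ 2 _ 2])
  finally show ?thesis using C by simp
qed

text \<open>The quadratic form takes the values 2 p and 2 m at the eigenvectors (1, 1) and (1,
  -1).\<close>

lemma positive_definite_swap_matD:
  assumes "positive_definite (swap_mat p m)"
  shows "0 < p" "0 < m"
proof -
  have *: "0 < scalar_prod v (swap_mat p m *\<^sub>v v)" if "v \<in> carrier_vec 2" "v \<noteq> 0\<^sub>v 2" for v
    using assms that by (auto simp: positive_definite_def)
  define v where "v s = Matrix.vec 2 (\<lambda>i. if i = 0 then 1 else s)" for s :: real
  have "v s \<in> carrier_vec 2" for s by (simp add: v_def)
  moreover have "v s \<noteq> 0\<^sub>v 2" for s
  proof
    assume "v s = 0\<^sub>v 2"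
    then have "v s $ 0 = 0\<^sub>v 2 $ 0" by simp
    then show False by (simp add: v_def)
  qed
  ultimately have "0 < scalar_prod (v s) (swap_mat p m *\<^sub>v v s)" for s
    using * by blast
  from this[of 1] this[of "-1"] show "0 < p" "0 < m"
    by (simp_all add: v_def swap_mat_def scalar_prod_def numeral_2_eq_2
        add_divide_distrib diff_divide_distrib)
qed

section \<open>Moments of the uniform law and the Galerkin tensor\<close>

lemma moment_uniform:
  fixes P :: "'w measure" and \<nu> \<xi> :: "'w \<Rightarrow> real" and \<mu> \<sigma> :: real
  assumes "\<sigma> > 0"
    and dist: "distributed P lborel \<nu>
           (\<lambda>x. indicator {\<mu> - \<sigma>..\<mu> + \<sigma>} x / measure lborel {\<mu> - \<sigma>..\<mu> + \<sigma>})"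
    and \<nu>: "\<forall>\<omega>\<in>space P. \<nu> \<omega> = \<mu> + \<sigma> * \<xi> \<omega>"
  shows "(\<integral>x. x ^ k \<partial>distr P borel \<xi>) = (1 - (-1) ^ Suc k) / (2 * real (Suc k))"
proof -
  have [measurable]: "\<nu> \<in> borel_measurable P"
    using distributed_measurable[OF dist] by simp
  \<comment> \<open>On \<open>space P\<close> the variable \<xi> is an affine function of \<nu>;
    this gives measurability and moves the moments to the known density of \<nu>.\<close>
  have \<xi>: "\<xi> \<omega> = (\<nu> \<omega> - \<mu>) / \<sigma>" if "\<omega> \<in> space P" for \<omega>
    using \<nu> that \<open>\<sigma> > 0\<close> by (simp add: field_simps)
  have "distr P borel \<xi> = distr P borel (\<lambda>\<omega>. (\<nu> \<omega> - \<mu>) / \<sigma>)"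
    by (intro distr_cong) (simp_all add: \<xi>)
  then have "(\<integral>x. x ^ k \<partial>distr P borel \<xi>) = (\<integral>\<omega>. ((\<nu> \<omega> - \<mu>) / \<sigma>) ^ k \<partial>P)"
    by (simp add: integral_distr)
  also have "\<dots> = (\<integral>x. (indicator {\<mu> - \<sigma>..\<mu> + \<sigma>} x / measure lborel {\<mu> - \<sigma>..\<mu> + \<sigma>})
      * ((x - \<mu>) / \<sigma>) ^ k \<partial>lborel)"
    by (rule distributed_integral[symmetric, OF dist]) simp_all
  also have "\<dots> = (\<integral>x. ((x - \<mu>) / \<sigma>) ^ k * indicator {\<mu> - \<sigma>..\<mu> + \<sigma>} x \<partial>lborel) / (2 * \<sigma>)"
    using \<open>\<sigma> > 0\<close> by (simp add: mult.commute)
  \<comment> \<open>The antiderivative is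
    \<open>\<sigma> * ((x - \<mu>) / \<sigma>) ^ Suc k / Suc k\<close>; at the endpoints the
    quotient is 1 and -1.\<close>
  also have "(\<integral>x. ((x - \<mu>) / \<sigma>) ^ k * indicator {\<mu> - \<sigma>..\<mu> + \<sigma>} x \<partial>lborel)
      = \<sigma> * ((\<mu> + \<sigma> - \<mu>) / \<sigma>) ^ Suc k / Suc k - \<sigma> * ((\<mu> - \<sigma> - \<mu>) / \<sigma>) ^ Suc k / Suc k"
    using \<open>\<sigma> > 0\<close>
    by (intro integral_FTC_Icc_real)
      (auto intro!: derivative_eq_intros continuous_intros
        simp del: of_nat_Suc power_Suc power_divide)
  also have "\<dots> / (2 * \<sigma>) = (1 - (-1) ^ Suc k) / (2 * real (Suc k))"
    using \<open>\<sigma> > 0\<close> by (simp add: diff_divide_distrib mult.commute del: of_nat_Suc power_Suc)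
  finally show ?thesis .
qed

text \<open>The tensor entries are multiples of moments up to order 3. Odd moments vanish, so the
  tensor for k = 0 is the identity and the one for k = 1 is the exchange matrix.\<close>

lemma galerkin_mat_eq_swap_mat:
  assumes mom: "\<And>k. (\<integral>x. x ^ k \<partial>L) = (1 - (-1) ^ Suc k) / (2 * real (Suc k))"
  shows "galerkin_mat L v = swap_mat (v $ 0 + v $ 1) (v $ 0 - v $ 1)"
proof -
  have legendre: "legendre_poly 0 = 1" "legendre_poly (Suc 0) = [:0, 1:]"
    by (simp_all add: legendre_poly_def pderiv_pCons)
  \<comment> \<open>Normalising constants of the Legendre polynomials 1 and x, whose second moments
    are 1 and 1/3.\<close>
  define w :: "nat \<Rightarrow> real" where "w k = (if k = 0 then 1 else sqrt 3)" for k
  have second_moment: "(\<integral>x. x\<^sup>2 \<partial>L) = 1 / 3" using mom[of 2] by simp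
  have psi: "psi L k x = w k * x ^ k" if "k < 2" for k x
    using that mom[of 0]
    by (auto simp: second_moment psi_def legendre w_def less_2_cases_iff real_sqrt_divide)
  have tensor: "galerkin_tensor L k $$ (i, j)
      = w k * w i * w j * ((1 - (-1) ^ Suc (k + i + j)) / (2 * real (Suc (k + i + j))))"
    if "k < 2" "i < 2" "j < 2" for k i j
  proof -
    have "galerkin_tensor L k $$ (i, j) = (\<integral>x. (w k * w i * w j) * x ^ (k + i + j) \<partial>L)"
      using that by (simp add: galerkin_tensor_def psi power_add mult_ac)
    then show ?thesis by (simp only: mom integral_mult_right_zero)
  qed
  have "galerkin_tensor L 0 = swap_mat 1 1" "galerkin_tensor L 1 = swap_mat 1 (-1)"
    by (auto intro!: eq_matI simp: tensor w_def swap_mat_index less_2_cases_iff)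
      (simp_all add: galerkin_tensor_def)
  then show ?thesis
    by (simp add: galerkin_mat_def swap_mat_smult swap_mat_add)
qed

text \<open>Sums, products and inverses of \<open>swap_mat\<close> matrices act on the two
  eigenvalues separately, so each block is computed by scalar arithmetic once for each
  eigenvector.\<close>

lemma sgswlme_block_eq_swap_mat:
  fixes W :: "real Matrix.vec"
  assumes gal: "\<And>v. galerkin_mat L v = swap_mat (v $ 0 + v $ 1) (v $ 0 - v $ 1)"
  defines "p \<equiv> \<lambda>v::real Matrix.vec. v $ 0 + v $ 1" and "m \<equiv> \<lambda>v::real Matrix.vec. v $ 0 - v $ 1"
  assumes h: "p (h_part W) \<noteq> 0" "m (h_part W) \<noteq> 0"
  shows "sgswlme_block L g N W r c = swap_mat
    (swlme_entry g (p (h_part W)) (\<lambda>j. p (q_part W j) / p (h_part W)) N r c)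
    (swlme_entry g (m (h_part W)) (\<lambda>j. m (q_part W j) / m (h_part W)) N r c)"
proof -
  have q: "q_part W j \<in> carrier_vec 2" for j by (simp add: q_part_def)
  show ?thesis
    unfolding sgswlme_block_def Let_def gal swap_mat_mult_vec[OF q]
      mat_inverse_swap_mat[OF h[unfolded p_def m_def]] option.sel
      swap_mat_mult swap_mat_add swap_mat_one swap_mat_zero swap_mat_sum
      swap_mat_uminus swap_mat_minus swap_mat_smult
    by (auto simp: swlme_entry_def p_def m_def power2_eq_square mult_ac)
qed

theorem mainTheorem3:
  fixes P :: "'w measure" and \<nu> \<xi> :: "'w \<Rightarrow> real" and \<mu> \<sigma> g :: real and N :: nat
    and S :: "real Matrix.vec \<Rightarrow> real Matrix.vec"
  assumes "prob_space P"
    and "\<sigma> > 0"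
    and "distributed P lborel \<nu>
           (\<lambda>x. indicator {\<mu> - \<sigma>..\<mu> + \<sigma>} x / measure lborel {\<mu> - \<sigma>..\<mu> + \<sigma>})"
    and "\<forall>\<omega>\<in>space P. \<nu> \<omega> = \<mu> + \<sigma> * \<xi> \<omega>"
    and "g > 0"
  shows "hyperbolic_on
           \<lparr>sysmat = sgswlme_matrix (distr P borel \<xi>) g N, source = S\<rparr>
           (sgswlme_states (distr P borel \<xi>) N)"
proof -
  define L where "L = distr P borel \<xi>"
  have gal: "galerkin_mat L v = swap_mat (v $ 0 + v $ 1) (v $ 0 - v $ 1)" for v
    unfolding L_def by (intro galerkin_mat_eq_swap_mat moment_uniform[OF assms(2-4)])
  have "diagonalisable (sgswlme_matrix L g N W)" if "W \<in> sgswlme_states L N" for W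
  proof -
    \<comment> \<open>The eigenvalue of the Galerkin matrix of v on (1, 1) for e = 0 and on (1, -1)
      for e = 1.\<close>
    define val :: "nat \<Rightarrow> real Matrix.vec \<Rightarrow> real" where "val e v = v $ 0 + (-1) ^ e * v $ 1" for e v
    define a where "a e = swlme_entry g (val e (h_part W))
      (\<lambda>j. val e (q_part W j) / val e (h_part W)) N" for e
    have pos: "0 < h_part W $ 0 + h_part W $ 1" "0 < h_part W $ 0 - h_part W $ 1"
      using that positive_definite_swap_matD[of "h_part W $ 0 + h_part W $ 1"
          "h_part W $ 0 - h_part W $ 1"]
      by (simp_all add: sgswlme_states_def gal)
    have "\<exists>l d. left_eigenbasis (N + 2) (a e) l d" if "e < 2" for e
    proof -
      have "0 < g * val e (h_part W)"
        using that pos \<open>g > 0\<close> by (auto simp: val_def less_2_cases_iff)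
      then show ?thesis unfolding a_def by (rule swlme_left_eigenbasis)
    qed
    then obtain l d where "\<And>e. e < 2 \<Longrightarrow> left_eigenbasis (N + 2) (a e) (l e) (d e)"
      by metis
    from diagonalisable_if_left_eigenbasis[OF left_eigenbasis_interleave[OF this]]
    show ?thesis
    proof (rule back_subst[of diagonalisable])
      \<comment> \<open>The sign inside a block depends on r mod 2 + c mod 2, which has the parity
        of r + c; this is the interleaved form.\<close>
      show "Matrix.mat (2 * (N + 2)) (2 * (N + 2)) (\<lambda>(r, c).
          (a 0 (r div 2) (c div 2) + (-1) ^ (r + c) * a 1 (r div 2) (c div 2)) / 2)
        = sgswlme_matrix L g N W"
        using pos
        by (intro eq_matI) (auto simp: sgswlme_matrix_def sgswlme_block_eq_swap_mat[OF gal]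
            swap_mat_index a_def val_def minus_one_power_iff)
    qed
  qed
  moreover have "sgswlme_matrix L g N W \<in> carrier_mat (2 * (N + 2)) (2 * (N + 2))" for W
    by (simp add: sgswlme_matrix_def)
  ultimately show ?thesis
    unfolding hyperbolic_on_def L_def[symmetric] first_order_system.select_convs
    by (auto intro: complex_eigenvalue_of_diagonalisable_real[rotated])
qed

end
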